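(* Let $\eta_n>0$. For every $n\geq 1$ and every $\delta$ satisfying $0<\delta<1$ we have: (a) Among all intervals $C_{S,n}=[\hat\theta_S-a_n,\hat\theta_S+b_n]$ ($a_n,b_n\ge 0$ real) with infimal coverage probability not less than $\delta$ there is a unique shortest interval $C_{S,n}^*=[\hat\theta_S-a_{n,S}^*,\hat\theta_S+b_{n,S}^*]$, characterized by $a_{n,S}^*=b_{n,S}^*$ with $a_{n,S}^*$ being the unique solution $a_n$ of $$\Phi(n^{1/2}(a_n-\eta_n))-\Phi(n^{1/2}(-a_n-\eta_n))=\delta.$$ The interval $C_{S,n}^*$ has infimal coverage probability equal to $\delta$ and $a_{n,S}^*$ is positive. (b) Among all intervals $C_{H,n}=[\hat\theta_H-a_n,\hat\theta_H+b_n]$ ($a_n,b_n\ge 0$ real) with infimal coverage probability not less than $\delta$ there is a unique shortest interval $C_{H,n}^*=[\hat\theta_H-a_{n,H}^*,\hat\theta_H+b_{n,H}^*]$, characterized by $a_{n,H}^*=b_{n,H}^*$ with $a_{n,H}^*$ being the unique solution $a_n$ of $$\Phi(n^{1/2}(a_n-\eta_n))-\Phi(-n^{1/2}a_n)=\delta.$$ The interval $C_{H,n}^*$ has infimal coverage probability equal to $\delta$ and $a_{n,H}^*$ satisfies $a_{n,H}^*>\eta_n/2$. (c) Among all intervals $C_{A,n}=[\hat\theta_A-a_n,\hat\theta_A+b_n]$ ($a_n,b_n\ge 0$ real) with infimal coverage probability not less than $\delta$ there is a unique shortest interval $C_{A,n}^*=[\hat\theta_A-a_{n,A}^*,\hat\theta_A+b_{n,A}^*]$,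 characterized by $a_{n,A}^*=b_{n,A}^*$ with $a_{n,A}^*$ being the unique solution $a_n$ of $$\Phi(n^{1/2}(a_n-\eta_n))-\Phi\left(-n^{1/2}\sqrt{a_n^2+\eta_n^2}\right)=\delta.$$ The interval $C_{A,n}^*$ has infimal coverage probability equal to $\delta$ and $a_{n,A}^*$ is positive.
   Context: The data $y_1,\dots,y_n$ are i.i.d. $N(\theta,1)$ with $\theta\in\mathbb{R}$ unknown (variance known and equal to $1$); $P_{n,\theta}$ denotes the distribution of the sample when $\theta$ is the true parameter, and $\bar y=n^{-1}\sum_{i=1}^n y_i$. The tuning parameter $\eta_n$ is a positive real number. The estimators are: soft-thresholding (LASSO) $\hat\theta_S=\operatorname{sign}(\bar y)(|\bar y|-\eta_n)_+$ with $z_+=\max\{z,0\}$ and $\operatorname{sign}(0)=0$; hard-thresholding $\hat\theta_H=\bar y\,\mathbf{1}(|\bar y|>\eta_n)$; adaptive LASSO $\hat\theta_A=0$ if $|\bar y|\le\eta_n$ and $\hat\theta_A=\bar y-\eta_n^2/\bar y$ if $|\bar y|>\eta_n$. For an interval $C=[\hat\theta-a_n,\hat\theta+b_n]$ with fixed nonnegative reals $a_n,b_n$, the infimal coverage probability is $\inf_{\theta\in\mathbb{R}}P_{n,\theta}(\theta\in C)$ and its length is $a_n+b_n$. $\Phi$ is the standard normal cumulative distribution function. *)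

theory Defs
  imports "HOL-Probability.Probability"
begin

text \<open>A sample of size \<open>n\<close> is a function on the index set \<open>{1..n}\<close>; its law is the product measure.\<close>

definition sample_law :: "nat \<Rightarrow> real \<Rightarrow> (nat \<Rightarrow> real) measure" where
  "sample_law n \<theta> = PiM {1..n} (\<lambda>_. density lborel (\<lambda>x. ennreal (normal_density \<theta> 1 x)))"

definition sample_mean :: "nat \<Rightarrow> (nat \<Rightarrow> real) \<Rightarrow> real" where
  "sample_mean n y = (\<Sum>i = 1..n. y i) / real n"

definition soft_threshold :: "nat \<Rightarrow> real \<Rightarrow> (nat \<Rightarrow> real) \<Rightarrow> real" where
  "soft_threshold n \<eta> y = sgn (sample_mean n y) * max (\<bar>sample_mean n y\<bar> - \<eta>) 0"

definition hard_threshold :: "nat \<Rightarrow> real \<Rightarrow> (nat \<Rightarrow> real) \<Rightarrow> real" where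
  "hard_threshold n \<eta> y = (if \<bar>sample_mean n y\<bar> > \<eta> then sample_mean n y else 0)"

definition adaptive_lasso :: "nat \<Rightarrow> real \<Rightarrow> (nat \<Rightarrow> real) \<Rightarrow> real" where
  "adaptive_lasso n \<eta> y =
     (if \<bar>sample_mean n y\<bar> \<le> \<eta> then 0 else sample_mean n y - \<eta>\<^sup>2 / sample_mean n y)"

definition coverage :: "nat \<Rightarrow> ((nat \<Rightarrow> real) \<Rightarrow> real) \<Rightarrow> real \<Rightarrow> real \<Rightarrow> real \<Rightarrow> real" where
  "coverage n est a b \<theta> =
     measure (sample_law n \<theta>) {y \<in> space (sample_law n \<theta>). \<theta> \<in> {est y - a .. est y + b}}"

definition inf_coverage :: "nat \<Rightarrow> ((nat \<Rightarrow> real) \<Rightarrow> real) \<Rightarrow> real \<Rightarrow> real \<Rightarrow> real" where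
  "inf_coverage n est a b = (INF \<theta>. coverage n est a b \<theta>)"

definition admissible :: "nat \<Rightarrow> ((nat \<Rightarrow> real) \<Rightarrow> real) \<Rightarrow> real \<Rightarrow> real \<Rightarrow> real \<Rightarrow> bool" where
  "admissible n est \<delta> a b \<longleftrightarrow> 0 \<le> a \<and> 0 \<le> b \<and> \<delta> \<le> inf_coverage n est a b"

text \<open>The interval with endpoints \<open>est - a\<close> and \<open>est + b\<close> is identified with the pair \<open>(a, b)\<close>;
  its length is \<open>a + b\<close>.\<close>

definition shortest :: "nat \<Rightarrow> ((nat \<Rightarrow> real) \<Rightarrow> real) \<Rightarrow> real \<Rightarrow> real \<Rightarrow> real \<Rightarrow> bool" where
  "shortest n est \<delta> a b \<longleftrightarrow>
     admissible n est \<delta> a b \<and> (\<forall>a' b'. admissible n est \<delta> a' b' \<longrightarrow> a + b \<le> a' + b')"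

definition Phi :: "real \<Rightarrow> real" where
  "Phi = cdf std_normal_distribution"

end

theory Submission
  imports Defs
begin

text \<open>
  All three estimators have the form \<open>h (sample mean)\<close> with \<open>h\<close> odd, and for \<open>u \<ge> 0\<close> the event
  \<open>h y \<le> u\<close> is a half-line \<open>y \<le> u + g u\<close>, where the excess \<open>g\<close> is nonnegative, nonincreasing
  and continuous with \<open>g 0 = \<eta>\<close>. It is \<open>\<eta>\<close> for soft thresholding, \<open>max 0 (\<eta> - u)\<close> for hard thresholding
  and \<open>(sqrt (u\<^sup>2 + 4 * \<eta>\<^sup>2) - u) / 2\<close> for the adaptive LASSO. The proof is carried out once for such
  pairs, in the locale \<open>thresholding\<close>; the estimators enter only through \<open>g\<close>.

  Write \<open>F\<close> for the distribution function of the error of the sample mean. The coverage of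
  \<open>[h - a, h + b]\<close> is a sum of two values of \<open>F\<close> minus one (\<open>coverage_eq\<close>). It jumps where
  \<open>\<theta> + a\<close> or \<open>b - \<theta>\<close> changes sign, because there the estimator is zero with positive probability.
  The one-sided limit at the jump \<open>\<theta> = - a\<close> bounds the infimal coverage by
  \<open>F (a - g 0) + F (b + g (a + b)) - 1\<close>, and the limit at \<open>\<theta> = b\<close> gives the same bound with
  \<open>a\<close> and \<open>b\<close> exchanged. For \<open>a = b = c\<close> this bound is the infimal coverage.

  The comparison of intervals rests on a single property of the normal law: for \<open>m > 0\<close> the sum
  \<open>F (m - t) + F (m + t)\<close> strictly decreases in \<open>t \<ge> 0\<close>, since \<open>m + t\<close> is farther from the mode
  than \<open>m - t\<close>; it also strictly increases in \<open>m\<close>. For an interval of length \<open>2 * d\<close>, the smaller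
  of the two jump bounds is such a sum (minus one) with midpoint \<open>mid d\<close> and half-distance
  \<open>spread d + \<bar>a - b\<bar> / 2\<close>, where \<open>mid\<close> is nondecreasing, \<open>spread\<close> is nonincreasing and
  \<open>mid - spread\<close> is strictly increasing. As long as the coverage is positive, asymmetry or a smaller
  length therefore reduces it, so a symmetric interval with infimal coverage exactly \<open>\<delta>\<close> is the
  unique shortest one (\<open>admissible_not_longer_imp_symmetric\<close>); it exists by the intermediate value
  theorem. What remains for each estimator is to see that the stated equation cannot hold outside the
  range where it agrees with \<open>symmetric_coverage n x = \<delta>\<close>.
\<close>

section \<open>The standard normal distribution function\<close>

interpretation std_normal: real_distribution std_normal_distribution
  by (rule real_dist_normal_dist)

lemma Phi_diff_eq_integral:
  assumes "a \<le> b"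
  shows "Phi b - Phi a = integral {a..b} std_normal_density"
proof (cases "a = b")
  case False
  with assms have "a < b" by simp
  have i: "set_integrable lborel {a<..b} std_normal_density"
    by (rule set_integrable_subset[of _ UNIV]) (auto simp: set_integrable_def)
  have "Phi b - Phi a = measure std_normal_distribution {a<..b}"
    unfolding Phi_def using std_normal.cdf_diff_eq[OF \<open>a < b\<close>] by simp
  also have "\<dots> = (LINT x:{a<..b}|lborel. std_normal_density x)"
    using integral_density[of "indicat_real {a<..b}" lborel std_normal_density]
    by (simp add: set_lebesgue_integral_def mult.commute)
  also have "\<dots> = integral {a<..b} std_normal_density"
    using i by (rule set_borel_integral_eq_integral)
  also have "\<dots> = integral {a..b} std_normal_density"
    by (rule integral_spike_set) (auto intro: negligible_subset[of "{a}"])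
  finally show ?thesis .
qed simp

lemma DERIV_Phi: "(Phi has_real_derivative std_normal_density x) (at x)"
proof -
  have "((\<lambda>u. integral {x-1..u} std_normal_density) has_real_derivative std_normal_density x)
      (at x within {x-1..x+1})"
    by (rule integral_has_real_derivative) (auto simp: normal_density_def intro!: continuous_intros)
  then have "((\<lambda>u. integral {x-1..u} std_normal_density) has_real_derivative std_normal_density x) (at x)"
    by (simp add: at_within_Icc_at)
  then have "((\<lambda>u. Phi (x-1) + integral {x-1..u} std_normal_density) has_real_derivative std_normal_density x) (at x)"
    by (auto intro!: derivative_eq_intros)
  then show ?thesis
  proof (rule DERIV_cong_ev[THEN iffD1, rotated -1])
    show "\<forall>\<^sub>F u in nhds x. Phi (x-1) + integral {x-1..u} std_normal_density = Phi u"
      using order_tendstoD(1)[OF filterlim_ident, of "x-1" x]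
      by (auto elim!: eventually_mono simp flip: Phi_diff_eq_integral)
  qed auto
qed

lemma Phi_uminus: "Phi (- x) = 1 - Phi x"
proof -
  define S where "S = (\<lambda>x. Phi x + Phi (- x))"
  have "(S has_real_derivative 0) (at t)" for t
    unfolding S_def
    by (auto intro!: derivative_eq_intros DERIV_Phi DERIV_chain2[OF DERIV_Phi] simp: normal_density_def)
  then have const: "S t = S x" for t
    by (intro DERIV_isconst_all) auto
  have "(S \<longlongrightarrow> 1 + 0) at_top"
    unfolding S_def Phi_def
    by (intro tendsto_add std_normal.cdf_lim_at_top_prob
      filterlim_compose[OF std_normal.cdf_lim_at_bot filterlim_uminus_at_bot_at_top])
  moreover have "S = (\<lambda>_. S x)" using const by auto
  ultimately have "S x = 1"
    by (metis add_0_right tendsto_const_iff trivial_limit_at_top_linorder)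
  then show ?thesis by (simp add: S_def)
qed

lemma Phi_strict_mono: "x < y \<Longrightarrow> Phi x < Phi y"
  by (rule DERIV_pos_imp_increasing[of x y Phi]) (auto intro!: exI DERIV_Phi normal_density_pos)

lemma continuous_on_Phi: "continuous_on A Phi"
  by (meson DERIV_Phi DERIV_isCont continuous_at_imp_continuous_on)

text \<open>The derivative in \<open>t\<close> is the density at \<open>m + t\<close> minus the density at \<open>m - t\<close>, and the former
  point is farther from the mode.\<close>

lemma Phi_reflected_sum_strict_decreasing:
  assumes "0 < m" "0 \<le> s" "s < t"
  shows "Phi (m - t) + Phi (m + t) < Phi (m - s) + Phi (m + s)"
proof (rule DERIV_neg_imp_decreasing_open[OF \<open>s < t\<close>])
  fix x assume x: "s < x" "x < t"
  have "((\<lambda>t. Phi (m - t) + Phi (m + t)) has_real_derivative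
      (std_normal_density (m + x) - std_normal_density (m - x))) (at x)"
    by (auto intro!: derivative_eq_intros DERIV_chain2[OF DERIV_Phi])
  moreover have "(m - x)\<^sup>2 < (m + x)\<^sup>2"
    using assms x by (simp add: power2_sum power2_diff)
  then have "std_normal_density (m + x) < std_normal_density (m - x)"
    by (simp add: std_normal_density_def divide_strict_right_mono)
  ultimately show "\<exists>y. ((\<lambda>t. Phi (m - t) + Phi (m + t)) has_real_derivative y) (at x) \<and> y < 0"
    by (metis diff_less_0_iff_less)
qed (auto intro!: continuous_intros continuous_on_compose2[OF continuous_on_Phi])

section \<open>The law of the sample mean\<close>

lemma distributed_standardized_sample_mean:
  assumes "1 \<le> n"
  shows "distributed (sample_law n \<theta>) lborel (\<lambda>y. sqrt (real n) * (sample_mean n y - \<theta>)) std_normal_density"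
proof -
  let ?N = "density lborel (\<lambda>x. ennreal (normal_density \<theta> 1 x))"
  have N: "prob_space ?N" by (rule prob_space_normal_density) simp
  interpret prob_space "sample_law n \<theta>"
    unfolding sample_law_def by (intro prob_space_PiM N)
  have marginal: "distr (sample_law n \<theta>) borel (\<lambda>y. y i) = ?N" if "i \<in> {1..n}" for i
  proof -
    have "distr (sample_law n \<theta>) borel (\<lambda>y. y i) = distr (sample_law n \<theta>) ?N (\<lambda>y. y i)"
      by (rule distr_cong) auto
    also have "\<dots> = ?N"
      unfolding sample_law_def using that by (intro distr_PiM_component N)
    finally show ?thesis .
  qed
  have rv [measurable]: "(\<lambda>y. y i) \<in> borel_measurable (sample_law n \<theta>)" if "i \<in> {1..n}" for i
    using measurable_component_singleton[OF that, of "\<lambda>_. ?N"]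
    by (simp add: sample_law_def cong: measurable_cong_sets)
  have "distributed (sample_law n \<theta>) lborel (\<lambda>y. \<Sum>i\<in>{1..n}. y i)
      (normal_density (\<Sum>i\<in>{1..n}. \<theta>) (sqrt (\<Sum>i\<in>{1..n}. 1\<^sup>2)))"
  proof (rule sum_indep_normal)
    show "indep_vars (\<lambda>i. borel) (\<lambda>i y. y i) {1..n}"
    proof (subst indep_vars_iff_distr_eq_PiM')
      have "distr (sample_law n \<theta>) (\<Pi>\<^sub>M i\<in>{1..n}. borel) (\<lambda>x. \<lambda>i\<in>{1..n}. x i)
          = distr (sample_law n \<theta>) (sample_law n \<theta>) (\<lambda>x. x)"
        by (rule distr_cong)
          (auto simp: sample_law_def space_PiM PiE_def extensional_restrict intro!: sets_PiM_cong)
      also have "\<dots> = (\<Pi>\<^sub>M i\<in>{1..n}. distr (sample_law n \<theta>) borel (\<lambda>x. x i))"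
        unfolding distr_id2[OF refl] by (subst (1) sample_law_def) (intro PiM_cong refl marginal[symmetric])
      finally show "distr (sample_law n \<theta>) (\<Pi>\<^sub>M i\<in>{1..n}. borel) (\<lambda>x. \<lambda>i\<in>{1..n}. x i)
          = (\<Pi>\<^sub>M i\<in>{1..n}. distr (sample_law n \<theta>) borel (\<lambda>x. x i))" .
    qed (use assms rv in auto)
    fix i assume "i \<in> {1..n}"
    then show "distributed (sample_law n \<theta>) lborel (\<lambda>y. y i) (normal_density \<theta> 1)"
      using marginal[of i] rv[of i] by (simp add: distributed_def cong: distr_cong)
  qed (use assms in auto)
  then have "distributed (sample_law n \<theta>) lborel
      (\<lambda>y. ((\<Sum>i\<in>{1..n}. y i) - real n * \<theta>) / sqrt (real n)) std_normal_density"
    using assms by (subst (asm) normal_standard_normal_convert) simp_all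
  moreover have "((\<Sum>i\<in>{1..n}. y i) - real n * \<theta>) / sqrt (real n)
      = sqrt (real n) * (sample_mean n y - \<theta>)" for y :: "nat \<Rightarrow> real"
    using assms by (simp add: sample_mean_def field_simps flip: real_sqrt_mult)
      (simp add: real_sqrt_mult algebra_simps)?
  ultimately show ?thesis by simp
qed

text \<open>The event of covering the parameter is an interval whose endpoints may or may not belong to it,
  depending on the signs of its bounds and on the estimator. Sandwiching covers all these cases, and
  such a set is Borel because it is an open interval together with at most two points.\<close>

lemma measure_std_normal_interval:
  assumes "l \<le> u" "{l<..<u} \<subseteq> A" "A \<subseteq> {l..u}"
  shows "measure std_normal_distribution A = Phi u - Phi l" and "A \<in> sets borel"
proof -
  have "A = {l<..<u} \<union> (A \<inter> {l, u})"
    using assms by force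
  moreover have "A \<inter> {l, u} \<in> sets borel"
    by (intro borel_closed finite_imp_closed) auto
  ultimately show A: "A \<in> sets borel"
    by (metis borel_open open_greaterThanLessThan sets.Un)
  have "AE z in lborel. z \<noteq> l \<and> z \<noteq> u"
    using AE_lborel_singleton[of l] AE_lborel_singleton[of u] by auto
  then have "AE z in std_normal_distribution. z \<noteq> l \<and> z \<noteq> u"
    by (subst AE_density) auto
  then have "AE z in std_normal_distribution. z \<in> A \<longleftrightarrow> z \<in> {l<..u}"
    by eventually_elim (use assms in force)
  then have "measure std_normal_distribution A = measure std_normal_distribution {l<..u}"
    by (rule measure_eq_AE) (use A in auto)
  also have "\<dots> = Phi u - Phi l"
    using std_normal.cdf_diff_eq[of l u] assms(1) by (cases "l = u") (auto simp: Phi_def)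
  finally show "measure std_normal_distribution A = Phi u - Phi l" .
qed

text \<open>The distribution function of the error of the sample mean.\<close>

definition mean_cdf :: "nat \<Rightarrow> real \<Rightarrow> real" where
  "mean_cdf n x = Phi (sqrt (real n) * x)"

lemma measure_sample_mean_interval:
  assumes "1 \<le> n" "l \<le> u" "{l<..<u} \<subseteq> A" "A \<subseteq> {l..u}"
  shows "measure (sample_law n \<theta>) {y \<in> space (sample_law n \<theta>). sample_mean n y \<in> A}
    = mean_cdf n (u - \<theta>) - mean_cdf n (l - \<theta>)"
proof -
  define s where "s = sqrt (real n)"
  have s: "s > 0" using assms by (simp add: s_def)
  define B where "B = {z. \<theta> + z / s \<in> A}"
  let ?T = "\<lambda>y. s * (sample_mean n y - \<theta>)"
  have B: "{s * (l - \<theta>)<..<s * (u - \<theta>)} \<subseteq> B" "B \<subseteq> {s * (l - \<theta>)..s * (u - \<theta>)}"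
    using assms(3,4) s by (fastforce simp: B_def field_simps subset_iff)+
  have le: "s * (l - \<theta>) \<le> s * (u - \<theta>)"
    using s assms(2) by (simp add: mult_left_mono)
  note T = distributed_standardized_sample_mean[OF assms(1), of \<theta>, folded s_def]
  have "{y \<in> space (sample_law n \<theta>). sample_mean n y \<in> A} = ?T -` B \<inter> space (sample_law n \<theta>)"
    using s by (auto simp: B_def)
  then have "measure (sample_law n \<theta>) {y \<in> space (sample_law n \<theta>). sample_mean n y \<in> A}
      = measure (distr (sample_law n \<theta>) lborel ?T) B"
    using measure_std_normal_interval(2)[OF le B] distributed_measurable[OF T]
    by (simp add: measure_distr)
  also have "\<dots> = Phi (s * (u - \<theta>)) - Phi (s * (l - \<theta>))"
    using measure_std_normal_interval(1)[OF le B] distributed_distr_eq_density[OF T] by simp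
  finally show ?thesis by (simp add: mean_cdf_def s_def)
qed

lemma mean_cdf_uminus: "mean_cdf n (- x) = 1 - mean_cdf n x"
  by (simp add: mean_cdf_def Phi_uminus)

lemma mean_cdf_less_iff [simp]: "1 \<le> n \<Longrightarrow> mean_cdf n x < mean_cdf n y \<longleftrightarrow> x < y"
  by (simp add: mean_cdf_def strict_mono_less[OF strict_monoI[OF Phi_strict_mono]] mult_less_cancel_left)

lemma mean_cdf_le_iff [simp]: "1 \<le> n \<Longrightarrow> mean_cdf n x \<le> mean_cdf n y \<longleftrightarrow> x \<le> y"
  by (meson linorder_not_less mean_cdf_less_iff)

lemma continuous_on_mean_cdf: "continuous_on A (mean_cdf n)"
  unfolding mean_cdf_def by (intro continuous_intros continuous_on_compose2[OF continuous_on_Phi]) auto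

section \<open>Sums of the distribution function at reflected points\<close>

definition reflected_sum :: "nat \<Rightarrow> real \<Rightarrow> real \<Rightarrow> real" where
  "reflected_sum n m t = mean_cdf n (m - t) + mean_cdf n (m + t)"

lemma reflected_sum_zero: "reflected_sum n 0 t = 1"
  using mean_cdf_uminus[of n t] by (simp add: reflected_sum_def)

lemma reflected_sum_strict_mono_mid:
  assumes "1 \<le> n" "m < m'" shows "reflected_sum n m t < reflected_sum n m' t"
  using assms unfolding reflected_sum_def by (intro add_strict_mono) auto

lemma reflected_sum_strict_decreasing:
  assumes "1 \<le> n" "0 < m" "0 \<le> t" "t < t'"
  shows "reflected_sum n m t' < reflected_sum n m t"
  using assms Phi_reflected_sum_strict_decreasing[of "sqrt n * m" "sqrt n * t" "sqrt n * t'"]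
  by (simp add: reflected_sum_def mean_cdf_def algebra_simps)

text \<open>For \<open>m = 0\<close> the sum is constantly \<open>1\<close>, so the weak monotonicity in \<open>t\<close> extends to \<open>m \<ge> 0\<close>.\<close>

lemma reflected_sum_mono:
  assumes "1 \<le> n" "0 \<le> m" "m \<le> m'" "0 \<le> t'" "t' \<le> t"
  shows "reflected_sum n m t \<le> reflected_sum n m' t'"
proof -
  have "reflected_sum n m t \<le> reflected_sum n m t'"
    using reflected_sum_strict_decreasing[of n m t' t] assms
    by (cases "m = 0"; cases "t' = t") (auto simp: reflected_sum_zero)
  also have "\<dots> \<le> reflected_sum n m' t'"
    using reflected_sum_strict_mono_mid[of n m m' t'] assms by (cases "m = m'") auto
  finally show ?thesis .
qed

lemma reflected_sum_mono_eqD: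
  assumes "1 \<le> n" "0 < m" "m \<le> m'" "0 \<le> t'" "t' \<le> t"
    and "reflected_sum n m' t' \<le> reflected_sum n m t"
  shows "m = m'" "t = t'"
proof -
  show "m = m'"
    using reflected_sum_strict_mono_mid[of n m m' t'] reflected_sum_mono[of n m m t' t] assms
    by fastforce
  then show "t = t'"
    using reflected_sum_strict_decreasing[of n m t' t] assms by fastforce
qed

section \<open>Coverage of intervals around a thresholding estimator\<close>

lemma inf_coverage_le: "inf_coverage n est a b \<le> coverage n est a b \<theta>"
  unfolding inf_coverage_def
  by (rule cINF_lower) (auto intro!: bdd_belowI[of _ 0] simp: coverage_def)

text \<open>The excess \<open>g u\<close> measures how far the sample mean may exceed \<open>u\<close> while the estimate is still at
  most \<open>u\<close>. The half-line condition is imposed for \<open>u \<ge> 0\<close> only; oddness and continuity of \<open>g\<close>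
  recover the half-lines for negative \<open>u\<close> up to their endpoints. The last condition says that the
  decrease of \<open>g\<close> over a stretch of given length is largest when the stretch starts at \<open>0\<close>, as it is
  for convex \<open>g\<close>; it makes the jumps the worst case for symmetric intervals.\<close>

locale thresholding =
  fixes h g :: "real \<Rightarrow> real"
  assumes odd: "h (- y) = - h y"
    and le_iff: "0 \<le> u \<Longrightarrow> h y \<le> u \<longleftrightarrow> y \<le> u + g u"
    and nonneg: "0 \<le> u \<Longrightarrow> 0 \<le> g u"
    and antimono: "0 \<le> u \<Longrightarrow> u \<le> v \<Longrightarrow> g v \<le> g u"
    and cont: "continuous_on {0..} g"
    and exchange: "0 \<le> u \<Longrightarrow> 0 \<le> v \<Longrightarrow> g u + g v \<le> g 0 + g (u + v)"
begin

abbreviation estimator :: "nat \<Rightarrow> (nat \<Rightarrow> real) \<Rightarrow> real" where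
  "estimator n \<equiv> \<lambda>y. h (sample_mean n y)"

lemma excess_mono: "0 \<le> u \<Longrightarrow> u \<le> v \<Longrightarrow> u + g u \<le> v + g v"
  using le_iff[of u "u + g u"] le_iff[of v "u + g u"] by linarith

text \<open>The right end of the half-line \<open>{y. h y \<le> u}\<close>. The convention at \<open>u = 0\<close> reflects that \<open>h\<close>
  vanishes on the closed threshold region; \<open>upper\<close> jumps there from \<open>- g 0\<close> to \<open>g 0\<close>.\<close>

definition upper :: "real \<Rightarrow> real" where
  "upper u = (if 0 \<le> u then u + g u else u - g (- u))"

lemma upper_mono: "u \<le> v \<Longrightarrow> upper u \<le> upper v"
  using excess_mono[of u v] excess_mono[of "- v" "- u"] nonneg[of v] nonneg[of "- u"]
  by (auto simp: upper_def)

lemma upper_add_uminus_nonneg: "0 \<le> upper u + upper (- u)"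
  using nonneg[of 0] by (auto simp: upper_def)

text \<open>Every \<open>v\<close> in \<open>[0, w)\<close> satisfies \<open>v < h z\<close>, hence \<open>v + g v < z\<close>; now let \<open>v\<close> tend to \<open>w\<close>.\<close>

lemma ge_imp:
  assumes "0 < w" "w \<le> h z" shows "w + g w \<le> z"
proof (rule tendsto_upperbound)
  have "isCont g w"
    using continuous_on_interior[OF cont] assms(1) by simp
  then show "((\<lambda>v. v + g v) \<longlongrightarrow> w + g w) (at_left w)"
    by (intro tendsto_intros filterlim_mono[OF isContD order_refl at_le]) auto
  show "\<forall>\<^sub>F v in at_left w. v + g v \<le> z"
    using eventually_at_left_real[OF assms(1)]
  proof eventually_elim
    case (elim v)
    then show ?case using le_iff[of v z] assms(2) by auto
  qed
qed simp

lemma le_imp_le_upper: "h y \<le> u \<Longrightarrow> y \<le> upper u"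
  using le_iff[of u y] ge_imp[of "- u" "- y"] by (auto simp: upper_def odd)

lemma less_upper_imp_le: "y < upper u \<Longrightarrow> h y \<le> u"
  using le_iff[of u y] le_iff[of "- u" "- y"] by (auto simp: upper_def odd split: if_splits)

text \<open>By oddness the lower bound \<open>\<theta> - b \<le> h y\<close> is the upper bound \<open>h (- y) \<le> b - \<theta>\<close>, so both ends
  of the covering event are values of \<open>upper\<close>.\<close>

lemma coverage_eq:
  assumes "1 \<le> n" "0 \<le> a" "0 \<le> b"
  shows "coverage n (estimator n) a b \<theta>
    = mean_cdf n (upper (\<theta> + a) - \<theta>) + mean_cdf n (upper (b - \<theta>) + \<theta>) - 1"
proof -
  let ?A = "{x. \<theta> - b \<le> h x \<and> h x \<le> \<theta> + a}"
  have "{y \<in> space (sample_law n \<theta>). \<theta> \<in> {h (sample_mean n y) - a..h (sample_mean n y) + b}}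
      = {y \<in> space (sample_law n \<theta>). sample_mean n y \<in> ?A}"
    by auto
  then have "coverage n (estimator n) a b \<theta>
      = measure (sample_law n \<theta>) {y \<in> space (sample_law n \<theta>). sample_mean n y \<in> ?A}"
    by (simp add: coverage_def)
  also have "\<dots> = mean_cdf n (upper (\<theta> + a) - \<theta>) - mean_cdf n (- upper (b - \<theta>) - \<theta>)"
  proof (rule measure_sample_mean_interval[OF assms(1)])
    show "- upper (b - \<theta>) \<le> upper (\<theta> + a)"
      using upper_add_uminus_nonneg[of "b - \<theta>"] upper_mono[of "- (b - \<theta>)" "\<theta> + a"] assms by simp
    show "{- upper (b - \<theta>)<..<upper (\<theta> + a)} \<subseteq> ?A"
    proof
      fix x assume "x \<in> {- upper (b - \<theta>)<..<upper (\<theta> + a)}"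
      then show "x \<in> ?A"
        using less_upper_imp_le[of x "\<theta> + a"] less_upper_imp_le[of "- x" "b - \<theta>"]
        by (simp add: odd)
    qed
    show "?A \<subseteq> {- upper (b - \<theta>)..upper (\<theta> + a)}"
    proof
      fix x assume "x \<in> ?A"
      then show "x \<in> {- upper (b - \<theta>)..upper (\<theta> + a)}"
        using le_imp_le_upper[of x "\<theta> + a"] le_imp_le_upper[of "- x" "b - \<theta>"]
        by (simp add: odd)
    qed
  qed
  also have "mean_cdf n (- upper (b - \<theta>) - \<theta>) = 1 - mean_cdf n (upper (b - \<theta>) + \<theta>)"
    using mean_cdf_uminus[of n "upper (b - \<theta>) + \<theta>"] by simp
  finally show ?thesis by simp
qed

lemma coverage_reflect:
  assumes "1 \<le> n" "0 \<le> a" "0 \<le> b"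
  shows "coverage n (estimator n) a b (- \<theta>) = coverage n (estimator n) b a \<theta>"
  using assms by (simp add: coverage_eq add.commute)

lemma inf_coverage_commute:
  assumes "1 \<le> n" "0 \<le> a" "0 \<le> b"
  shows "inf_coverage n (estimator n) a b = inf_coverage n (estimator n) b a"
proof -
  have "range (coverage n (estimator n) b a) = (\<lambda>\<theta>. coverage n (estimator n) a b (- \<theta>)) ` UNIV"
    using coverage_reflect[OF assms] by simp
  also have "\<dots> = coverage n (estimator n) a b ` range uminus"
    by (simp only: image_image)
  finally have "range (coverage n (estimator n) b a) = range (coverage n (estimator n) a b)"
    by simp
  then show ?thesis by (simp add: inf_coverage_def)
qed

text \<open>The bound is the limit of the coverage as \<open>\<theta>\<close> approaches \<open>- a\<close> from below.\<close>

lemma inf_coverage_le_jump: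
  assumes n: "1 \<le> n" and "0 \<le> a" "0 \<le> b"
  shows "inf_coverage n (estimator n) a b
    \<le> mean_cdf n (a - g 0) + mean_cdf n (b + g (a + b)) - 1"
proof (rule tendsto_lowerbound)
  have g0: "(g \<longlongrightarrow> g v) (at_right v)" if "0 \<le> v" for v
    using cont that by (auto simp: continuous_on_def intro: tendsto_within_subset)
  have lim1: "((\<lambda>e. a - g e) \<longlongrightarrow> a - g 0) (at_right 0)"
    by (intro tendsto_intros g0) simp
  have "((\<lambda>e. g (a + b + e)) \<longlongrightarrow> g (a + b)) (at_right 0)"
    using g0[of "a + b"] assms by (simp add: filterlim_at_right_to_0[of g _ "a + b"] add.commute)
  then have lim2: "((\<lambda>e. b + g (a + b + e)) \<longlongrightarrow> b + g (a + b)) (at_right 0)"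
    by (intro tendsto_intros)
  have F: "((\<lambda>e. mean_cdf n (f e)) \<longlongrightarrow> mean_cdf n l) (at_right 0)"
    if "(f \<longlongrightarrow> l) (at_right (0::real))" for f l
    using that continuous_on_mean_cdf[of UNIV n]
    by (intro isCont_tendsto_compose[of _ "mean_cdf n"]) (auto simp: continuous_on_eq_continuous_at)
  show "((\<lambda>e. mean_cdf n (a - g e) + mean_cdf n (b + g (a + b + e)) - 1)
      \<longlongrightarrow> mean_cdf n (a - g 0) + mean_cdf n (b + g (a + b)) - 1) (at_right 0)"
    by (intro tendsto_intros F lim1 lim2)
  show "\<forall>\<^sub>F e in at_right 0. inf_coverage n (estimator n) a b
      \<le> mean_cdf n (a - g e) + mean_cdf n (b + g (a + b + e)) - 1"
    using eventually_at_right_less[of 0]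
  proof eventually_elim
    case (elim e)
    \<comment> \<open>The parameter \<open>- a - e\<close> lies just beyond the jump, so that \<open>\<theta> + a\<close> is negative.\<close>
    have "coverage n (estimator n) a b (- a - e)
        = mean_cdf n (a - g e) + mean_cdf n (b + g (a + b + e)) - 1"
      using assms elim by (simp add: coverage_eq upper_def algebra_simps)
    then show ?case by (metis inf_coverage_le)
  qed
qed simp

section \<open>Optimality of symmetric intervals\<close>

text \<open>For \<open>a = b = c\<close> the two arguments of the distribution function in the jump bound are
  \<open>c - g 0\<close> and \<open>c + g (2 * c)\<close>. Their midpoint and half their distance are the natural
  coordinates, since the bound is monotone in each of them and each is monotone in \<open>c\<close>.\<close>

definition mid :: "real \<Rightarrow> real" where "mid c = c + (g (2 * c) - g 0) / 2"
definition spread :: "real \<Rightarrow> real" where "spread c = (g (2 * c) + g 0) / 2"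

definition symmetric_coverage :: "nat \<Rightarrow> real \<Rightarrow> real" where
  "symmetric_coverage n c = mean_cdf n (c - g 0) + mean_cdf n (c + g (2 * c)) - 1"

lemma symmetric_coverage_eq: "symmetric_coverage n c = reflected_sum n (mid c) (spread c) - 1"
proof -
  have "mid c - spread c = c - g 0" "mid c + spread c = c + g (2 * c)"
    by (simp_all add: mid_def spread_def) argo+
  then show ?thesis by (simp add: symmetric_coverage_def reflected_sum_def)
qed

lemma mid_nonneg: "0 \<le> c \<Longrightarrow> 0 \<le> mid c"
  using excess_mono[of 0 "2 * c"] by (simp add: mid_def) argo

lemma mid_mono: "0 \<le> c \<Longrightarrow> c \<le> c' \<Longrightarrow> mid c \<le> mid c'"
  using excess_mono[of "2 * c" "2 * c'"] by (simp add: mid_def) argo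

lemma spread_nonneg: "0 \<le> c \<Longrightarrow> 0 \<le> spread c"
  using nonneg[of 0] nonneg[of "2 * c"] by (simp add: spread_def)

lemma spread_antimono: "0 \<le> c \<Longrightarrow> c \<le> c' \<Longrightarrow> spread c' \<le> spread c"
  using antimono[of "2 * c" "2 * c'"] by (simp add: spread_def)

text \<open>For fixed length, the jump bound at the endpoint belonging to the shorter arm only moves its two
  arguments symmetrically away from \<open>mid\<close>, by half the difference of the arms.\<close>

lemma inf_coverage_le_reflected_sum:
  assumes n: "1 \<le> n" and "0 \<le> a" "0 \<le> b"
  shows "inf_coverage n (estimator n) a b
    \<le> reflected_sum n (mid ((a + b) / 2)) (spread ((a + b) / 2) + \<bar>a - b\<bar> / 2) - 1"
  using assms
proof (induction a b rule: linorder_wlog)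
  case (le a b)
  then have "mid ((a + b) / 2) - (spread ((a + b) / 2) + \<bar>a - b\<bar> / 2) = a - g 0"
    "mid ((a + b) / 2) + (spread ((a + b) / 2) + \<bar>a - b\<bar> / 2) = b + g (a + b)"
    by (simp_all add: mid_def spread_def) argo+
  then show ?case
    using inf_coverage_le_jump[of n a b] le by (simp add: reflected_sum_def)
next
  case (sym a b)
  then show ?case
    by (simp add: inf_coverage_commute[of n b a] add.commute abs_minus_commute)
qed

text \<open>By symmetry let \<open>\<theta> \<ge> 0\<close>. If \<open>\<theta> \<le> c\<close>, each summand is at least its counterpart at the jump. If
  \<open>\<theta> > c\<close>, then moving \<open>\<theta>\<close> away from the jump raises one summand and lowers the other; the
  condition \<open>exchange\<close> says that the midpoint of the two arguments does not decrease, and their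
  distance shrinks because \<open>g\<close> does.\<close>

lemma symmetric_coverage_le_coverage:
  assumes n: "1 \<le> n" and c: "0 \<le> c"
  shows "symmetric_coverage n c \<le> coverage n (estimator n) c c \<theta>"
proof -
  have *: "symmetric_coverage n c \<le> coverage n (estimator n) c c \<theta>" if "0 \<le> \<theta>" for \<theta>
  proof (cases "\<theta> \<le> c")
    case True
    have "coverage n (estimator n) c c \<theta> = mean_cdf n (c + g (\<theta> + c)) + mean_cdf n (c + g (c - \<theta>)) - 1"
      using n c that True by (simp add: coverage_eq upper_def)
    moreover have "mean_cdf n (c + g (2 * c)) \<le> mean_cdf n (c + g (\<theta> + c))"
      using n c that True by (simp add: antimono)
    moreover have "mean_cdf n (c - g 0) \<le> mean_cdf n (c + g (c - \<theta>))"
      using n nonneg[of 0] nonneg[of "c - \<theta>"] True by simp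
    ultimately show ?thesis by (simp add: symmetric_coverage_def)
  next
    case False
    define p q where "p = g (\<theta> - c)" and "q = g (\<theta> + c)"
    have "coverage n (estimator n) c c \<theta> = mean_cdf n (c - p) + mean_cdf n (c + q) - 1"
      using n c that False by (simp add: coverage_eq upper_def p_def q_def)
    also have "c - p = c + (q - p) / 2 - (p + q) / 2" by argo
    also have "c + q = c + (q - p) / 2 + (p + q) / 2" by argo
    finally have cov: "coverage n (estimator n) c c \<theta>
        = reflected_sum n (c + (q - p) / 2) ((p + q) / 2) - 1"
      by (simp only: reflected_sum_def)
    have "p \<le> g 0" "q \<le> g (2 * c)" "0 \<le> p" "0 \<le> q" "p + g (2 * c) \<le> g 0 + q"
      using antimono[of 0 "\<theta> - c"] antimono[of "2 * c" "\<theta> + c"] nonneg[of "\<theta> - c"]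
        nonneg[of "\<theta> + c"] exchange[of "\<theta> - c" "2 * c"] False c
      by (auto simp: p_def q_def algebra_simps)
    then have "reflected_sum n (mid c) (spread c)
        \<le> reflected_sum n (c + (q - p) / 2) ((p + q) / 2)"
      by (intro reflected_sum_mono n mid_nonneg c) (auto simp: mid_def spread_def field_simps)
    then show ?thesis by (simp add: cov symmetric_coverage_eq)
  qed
  show ?thesis
    using *[of \<theta>] *[of "- \<theta>"] coverage_reflect[OF n c c, of \<theta>] by (cases "0 \<le> \<theta>") auto
qed

text \<open>The infimum is the limit at the jumps.\<close>

lemma inf_coverage_symmetric:
  assumes "1 \<le> n" "0 \<le> c"
  shows "inf_coverage n (estimator n) c c = symmetric_coverage n c"
proof (rule antisym)
  show "inf_coverage n (estimator n) c c \<le> symmetric_coverage n c"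
    using inf_coverage_le_jump[of n c c] assms by (simp add: symmetric_coverage_def)
  show "symmetric_coverage n c \<le> inf_coverage n (estimator n) c c"
    unfolding inf_coverage_def
    by (rule cINF_greatest) (auto intro: symmetric_coverage_le_coverage assms)
qed

text \<open>An interval of length \<open>2 * d \<le> 2 * c\<close> has midpoint at most \<open>mid c\<close> and half-distance at least
  \<open>spread c\<close>. To still reach coverage \<open>\<delta>\<close> it must match both, which leaves no room for asymmetry;
  and \<open>mid c - spread c = c - g 0\<close> determines \<open>c\<close>. Strictness in \<open>t\<close> needs a positive midpoint,
  and midpoint zero would mean coverage zero.\<close>

lemma admissible_not_longer_imp_symmetric:
  assumes n: "1 \<le> n" and c: "0 \<le> c" "symmetric_coverage n c = \<delta>" and "0 < \<delta>"
    and ab: "admissible n (estimator n) \<delta> a b" "a + b \<le> 2 * c"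
  shows "a = c" "b = c"
proof -
  define d e where "d = (a + b) / 2" and "e = \<bar>a - b\<bar> / 2"
  have "0 \<le> e" by (simp add: e_def)
  have nn: "0 \<le> a" "0 \<le> b" "0 \<le> d" "d \<le> c" using ab by (auto simp: admissible_def d_def)
  have le: "\<delta> \<le> reflected_sum n (mid d) (spread d + e) - 1"
    using inf_coverage_le_reflected_sum[OF n nn(1,2)] ab(1) by (simp add: admissible_def d_def e_def)
  have "mid d \<noteq> 0" using le \<open>0 < \<delta>\<close> by (auto simp: reflected_sum_zero)
  then have "0 < mid d" using mid_nonneg[OF nn(3)] by simp
  moreover have "spread c \<le> spread d" using spread_antimono nn by simp
  moreover from this have "spread c \<le> spread d + e"
    using \<open>0 \<le> e\<close> by simp
  moreover have "reflected_sum n (mid c) (spread c)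
      \<le> reflected_sum n (mid d) (spread d + e)"
    using le c(2) by (simp add: symmetric_coverage_eq)
  ultimately have "mid d = mid c" "spread d + e = spread c"
    using reflected_sum_mono_eqD[OF n _ mid_mono[OF nn(3,4)] spread_nonneg[OF c(1)],
      of "spread d + e"] by blast+
  moreover from this have "e = 0"
    using \<open>0 \<le> e\<close> \<open>spread c \<le> spread d\<close> by linarith
  ultimately have "a = b" "mid d - spread d = mid c - spread c"
    by (auto simp: e_def)
  then show "a = c" "b = c"
    by (auto simp: mid_def spread_def d_def field_simps)
qed

lemma ex_symmetric_coverage_eq:
  assumes n: "1 \<le> n" and "0 < \<delta>" "\<delta> < 1"
  shows "\<exists>c>0. symmetric_coverage n c = \<delta>"
proof -
  have s0: "symmetric_coverage n 0 = 0"
    by (simp add: symmetric_coverage_eq mid_def reflected_sum_zero)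
  have "\<forall>\<^sub>F x in at_top. (1 + \<delta>) / 2 < Phi x \<and> 0 < x"
    using order_tendstoD(1)[OF std_normal.cdf_lim_at_top_prob, of "(1 + \<delta>) / 2"] assms
    by (intro eventually_conj eventually_gt_at_top) (auto simp: Phi_def)
  then obtain x where x: "(1 + \<delta>) / 2 < Phi x" "0 < x"
    by (auto dest: eventually_happens'[rotated])
  \<comment> \<open>With this \<open>c\<close> both summands of the symmetric coverage exceed \<open>(1 + \<delta>) / 2\<close>.\<close>
  define c where "c = x / sqrt (real n) + g 0"
  have c: "0 \<le> c" using x nonneg[of 0] by (simp add: c_def)
  have "mean_cdf n (c - g 0) = Phi x" using n by (simp add: c_def mean_cdf_def)
  moreover have "mean_cdf n (c - g 0) \<le> mean_cdf n (c + g (2 * c))"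
    using n nonneg[of 0] nonneg[of "2 * c"] c by simp
  ultimately have "\<delta> \<le> symmetric_coverage n c"
    using x by (simp add: symmetric_coverage_def field_simps)
  moreover have "continuous_on {0..c} (symmetric_coverage n)"
    unfolding symmetric_coverage_def
    by (intro continuous_intros continuous_on_compose2[OF continuous_on_mean_cdf[of UNIV]]
      continuous_on_compose2[OF cont]) auto
  ultimately obtain z where "0 \<le> z" "symmetric_coverage n z = \<delta>"
    using IVT'[of "symmetric_coverage n" 0 \<delta> c] s0 assms c by auto
  moreover have "z \<noteq> 0" using calculation s0 assms by auto
  ultimately show ?thesis by (intro exI[of _ z]) auto
qed

text \<open>The function \<open>E\<close> stands for the left-hand side of the equation that characterizes the half-length.
  Only its solutions at the level \<open>\<delta>\<close> matter: they must be nonnegative, as uniqueness is claimed among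
  all real numbers, and for hard thresholding \<open>E\<close> differs from \<open>symmetric_coverage\<close> at small \<open>x\<close>.\<close>

theorem unique_shortest_interval:
  fixes E :: "real \<Rightarrow> real"
  assumes n: "1 \<le> n" and \<delta>: "0 < \<delta>" "\<delta> < 1"
    and E: "\<And>x. E x = \<delta> \<longleftrightarrow> 0 \<le> x \<and> symmetric_coverage n x = \<delta>"
  shows "\<exists>a b. shortest n (estimator n) \<delta> a b
      \<and> (\<forall>a' b'. shortest n (estimator n) \<delta> a' b' \<longrightarrow> a' = a \<and> b' = b)
      \<and> a = b \<and> E a = \<delta> \<and> (\<forall>x. E x = \<delta> \<longrightarrow> x = a)
      \<and> inf_coverage n (estimator n) a b = \<delta> \<and> 0 < a"
proof -
  obtain c where c: "0 < c" "symmetric_coverage n c = \<delta>"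
    using ex_symmetric_coverage_eq[OF n \<delta>] by blast
  then have "0 \<le> c" by simp
  note only = admissible_not_longer_imp_symmetric[OF n _ _ \<delta>(1)]
  have adm: "admissible n (estimator n) \<delta> x x" if "0 \<le> x" "symmetric_coverage n x = \<delta>" for x
    using that n by (simp add: admissible_def inf_coverage_symmetric)
  note adm_c = adm[OF \<open>0 \<le> c\<close> c(2)]
  have "shortest n (estimator n) \<delta> c c"
    unfolding shortest_def
  proof (intro conjI allI impI adm_c)
    fix a b assume "admissible n (estimator n) \<delta> a b"
    then show "c + c \<le> a + b"
      using only[OF \<open>0 \<le> c\<close> c(2), of a b] by (cases "a + b \<le> 2 * c") auto
  qed
  moreover have "a = c \<and> b = c" if "shortest n (estimator n) \<delta> a b" for a b
  proof -
    have "admissible n (estimator n) \<delta> a b" "a + b \<le> 2 * c"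
      using that adm_c unfolding shortest_def by fastforce+
    then show ?thesis using only[OF \<open>0 \<le> c\<close> c(2)] by simp
  qed
  moreover have "x = c" if "E x = \<delta>" for x
  proof -
    have x: "0 \<le> x" "symmetric_coverage n x = \<delta>" using that E by auto
    show ?thesis
      using only(1)[OF x adm_c] only(1)[OF \<open>0 \<le> c\<close> c(2) adm[OF x]] by (cases "x \<le> c") auto
  qed
  moreover have "inf_coverage n (estimator n) c c = \<delta>" "E c = \<delta>"
    using c E n by (simp_all add: inf_coverage_symmetric)
  ultimately show ?thesis
    using c(1) by blast
qed

end

section \<open>Soft, hard and adaptive thresholding\<close>

lemma thresholding_soft:
  assumes "0 < \<eta>"
  shows "thresholding (\<lambda>y. sgn y * max (\<bar>y\<bar> - \<eta>) 0) (\<lambda>_. \<eta>)"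
  by standard (use assms in \<open>auto simp: sgn_if max_def\<close>)

lemma thresholding_hard:
  assumes "0 < \<eta>"
  shows "thresholding (\<lambda>y. if \<eta> < \<bar>y\<bar> then y else 0) (\<lambda>u. max 0 (\<eta> - u))"
proof
  show "continuous_on {0..} (\<lambda>u. max 0 (\<eta> - u))"
    by (intro continuous_intros)
qed (use assms in \<open>auto simp: max_def\<close>)

text \<open>For \<open>y > \<eta>\<close> the inequality \<open>y - \<eta>\<^sup>2 / y \<le> u\<close> is quadratic, and \<open>u\<close> plus the excess is the positive root of
  \<open>y\<^sup>2 - u * y = \<eta>\<^sup>2\<close>.\<close>

lemma thresholding_adaptive:
  assumes "0 < \<eta>"
  shows "thresholding (\<lambda>y. if \<bar>y\<bar> \<le> \<eta> then 0 else y - \<eta>\<^sup>2 / y)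
    (\<lambda>u. (sqrt (u\<^sup>2 + 4 * \<eta>\<^sup>2) - u) / 2)"
proof
  fix y u :: real assume u: "0 \<le> u"
  define r where "r = (u + sqrt (u\<^sup>2 + 4 * \<eta>\<^sup>2)) / 2"
  have r: "\<eta> \<le> r" "u \<le> r"
    using u real_le_rsqrt[of "2 * \<eta>" "u\<^sup>2 + 4 * \<eta>\<^sup>2"] real_le_rsqrt[of u "u\<^sup>2 + 4 * \<eta>\<^sup>2"]
    by (auto simp: r_def)
  have "2 * r - u = sqrt (u\<^sup>2 + 4 * \<eta>\<^sup>2)"
    unfolding r_def by argo
  then have "(2 * r - u)\<^sup>2 = u\<^sup>2 + 4 * \<eta>\<^sup>2"
    by simp
  then have root: "\<eta>\<^sup>2 = r\<^sup>2 - u * r"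
    by (simp add: power2_eq_square algebra_simps)
  have "(if \<bar>y\<bar> \<le> \<eta> then 0 else y - \<eta>\<^sup>2 / y) \<le> u \<longleftrightarrow> y \<le> r"
  proof -
    consider "\<bar>y\<bar> \<le> \<eta>" | "y < - \<eta>" | "\<eta> < y" by linarith
    then show ?thesis
    proof cases
      case 2
      have "\<eta> * \<eta> < y * y"
        using mult_strict_mono[of \<eta> "- y" \<eta> "- y"] 2 assms by simp
      then have "y - \<eta>\<^sup>2 / y \<le> 0"
        using 2 assms by (simp add: field_simps power2_eq_square)
      then show ?thesis using 2 assms u r by auto
    next
      case 3
      then have "y - \<eta>\<^sup>2 / y \<le> u \<longleftrightarrow> y * y - u * y \<le> \<eta>\<^sup>2"
        using assms by (simp add: field_simps power2_eq_square)
      also have "\<dots> \<longleftrightarrow> (y - r) * (y + r - u) \<le> 0"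
        unfolding root by (simp add: algebra_simps power2_eq_square)
      also have "\<dots> \<longleftrightarrow> y \<le> r"
        using 3 assms r by (simp add: mult_le_0_iff)
      finally show ?thesis using 3 assms by auto
    qed (use u r in auto)
  qed
  then show "(if \<bar>y\<bar> \<le> \<eta> then 0 else y - \<eta>\<^sup>2 / y) \<le> u
      \<longleftrightarrow> y \<le> u + (sqrt (u\<^sup>2 + 4 * \<eta>\<^sup>2) - u) / 2"
    by (simp add: r_def field_simps)
  show "0 \<le> (sqrt (u\<^sup>2 + 4 * \<eta>\<^sup>2) - u) / 2"
    using r(2) by (simp add: r_def)
next
  fix u v :: real assume uv: "0 \<le> u" "u \<le> v"
  have "u \<le> sqrt (u\<^sup>2 + 4 * \<eta>\<^sup>2)" by (rule real_le_rsqrt) simp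
  then have "0 \<le> 2 * (v - u) * (sqrt (u\<^sup>2 + 4 * \<eta>\<^sup>2) - u)" using uv by simp
  moreover have "(sqrt (u\<^sup>2 + 4 * \<eta>\<^sup>2) + (v - u))\<^sup>2
      = v\<^sup>2 + 4 * \<eta>\<^sup>2 + 2 * (v - u) * (sqrt (u\<^sup>2 + 4 * \<eta>\<^sup>2) - u)"
    by (simp add: power2_sum) (simp add: power2_eq_square algebra_simps)
  ultimately have "sqrt (v\<^sup>2 + 4 * \<eta>\<^sup>2) \<le> sqrt (u\<^sup>2 + 4 * \<eta>\<^sup>2) + (v - u)"
    using uv by (intro real_le_lsqrt) auto
  then show "(sqrt (v\<^sup>2 + 4 * \<eta>\<^sup>2) - v) / 2 \<le> (sqrt (u\<^sup>2 + 4 * \<eta>\<^sup>2) - u) / 2"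
    by simp
next
  show "continuous_on {0..} (\<lambda>u. (sqrt (u\<^sup>2 + 4 * \<eta>\<^sup>2) - u) / 2)"
    by (intro continuous_intros) auto
next
  fix u v :: real assume uv: "0 \<le> u" "0 \<le> v"
  \<comment> \<open>Multiplied by \<open>2\<close>, the claim is \<open>A + B \<le> 2 * \<eta> + C\<close>; two squarings remove the roots.\<close>
  define A B C where "A = sqrt (u\<^sup>2 + 4 * \<eta>\<^sup>2)" and "B = sqrt (v\<^sup>2 + 4 * \<eta>\<^sup>2)"
    and "C = sqrt ((u + v)\<^sup>2 + 4 * \<eta>\<^sup>2)"
  have sq: "A\<^sup>2 = u\<^sup>2 + 4 * \<eta>\<^sup>2" "B\<^sup>2 = v\<^sup>2 + 4 * \<eta>\<^sup>2" "C\<^sup>2 = (u + v)\<^sup>2 + 4 * \<eta>\<^sup>2"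
    by (simp_all add: A_def B_def C_def)
  have pos: "0 \<le> C" by (simp add: C_def)
  have sqrt4: "sqrt (4 * \<eta>\<^sup>2) = 2 * \<eta>"
    using assms by (intro real_sqrt_unique) (auto simp: power_mult_distrib)
  have "(u * v + 2 * \<eta> * C)\<^sup>2 = (u * v)\<^sup>2 + 4 * \<eta>\<^sup>2 * C\<^sup>2 + 4 * (u * v * \<eta> * C)"
    by (simp add: power2_eq_square algebra_simps)
  also have "\<dots> = (A * B)\<^sup>2 + 8 * \<eta>\<^sup>2 * (u * v) + 4 * (u * v * \<eta> * C)"
    unfolding power_mult_distrib[of A B] sq by (simp add: power2_eq_square algebra_simps)
  finally have "(A * B)\<^sup>2 \<le> (u * v + 2 * \<eta> * C)\<^sup>2"
    using uv pos assms by simp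
  then have "A * B \<le> u * v + 2 * \<eta> * C"
    by (rule power2_le_imp_le) (use uv pos assms in simp)
  then have "(A + B)\<^sup>2 \<le> (2 * \<eta> + C)\<^sup>2"
    using uv by (simp add: power2_sum sq power_mult_distrib)
  then have "A + B \<le> 2 * \<eta> + C"
    by (rule power2_le_imp_le) (use pos assms in simp)
  then show "(sqrt (u\<^sup>2 + 4 * \<eta>\<^sup>2) - u) / 2 + (sqrt (v\<^sup>2 + 4 * \<eta>\<^sup>2) - v) / 2
      \<le> (sqrt (0\<^sup>2 + 4 * \<eta>\<^sup>2) - 0) / 2 + (sqrt ((u + v)\<^sup>2 + 4 * \<eta>\<^sup>2) - (u + v)) / 2"
    using sqrt4 by (simp add: A_def B_def C_def) argo
qed auto

lemma unique_shortest_interval_soft: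
  fixes n :: nat and \<eta> \<delta> :: real
  assumes \<eta>: "\<eta> > 0" and n: "n \<ge> 1" and \<delta>: "0 < \<delta>" "\<delta> < 1"
  shows "\<exists>a b. shortest n (soft_threshold n \<eta>) \<delta> a b
            \<and> (\<forall>a' b'. shortest n (soft_threshold n \<eta>) \<delta> a' b' \<longrightarrow> a' = a \<and> b' = b)
            \<and> a = b
            \<and> Phi (sqrt (real n) * (a - \<eta>)) - Phi (sqrt (real n) * (- a - \<eta>)) = \<delta>
            \<and> (\<forall>x. Phi (sqrt (real n) * (x - \<eta>)) - Phi (sqrt (real n) * (- x - \<eta>)) = \<delta> \<longrightarrow> x = a)
            \<and> inf_coverage n (soft_threshold n \<eta>) a b = \<delta>
            \<and> a > 0"
proof -
  interpret thresholding "\<lambda>y. sgn y * max (\<bar>y\<bar> - \<eta>) 0" "\<lambda>_. \<eta>"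
    by (rule thresholding_soft[OF \<eta>])
  have est: "soft_threshold n \<eta> = estimator n"
    by (simp add: soft_threshold_def fun_eq_iff)
  have eq: "mean_cdf n (x - \<eta>) - mean_cdf n (- x - \<eta>) = symmetric_coverage n x" for x
    using mean_cdf_uminus[of n "x + \<eta>"] by (simp add: symmetric_coverage_def)
  \<comment> \<open>For negative \<open>x\<close> the difference is negative, hence not \<open>\<delta>\<close>.\<close>
  have nonneg: "0 \<le> x" if "symmetric_coverage n x = \<delta>" for x
    using that \<delta>(1) n unfolding eq[symmetric] by (smt (verit) mean_cdf_le_iff)
  show ?thesis
    unfolding est mean_cdf_def[symmetric] eq
    by (rule unique_shortest_interval[OF n \<delta>]) (use nonneg in blast)
qed

lemma unique_shortest_interval_hard:
  fixes n :: nat and \<eta> \<delta> :: real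
  assumes \<eta>: "\<eta> > 0" and n: "n \<ge> 1" and \<delta>: "0 < \<delta>" "\<delta> < 1"
  shows "\<exists>a b. shortest n (hard_threshold n \<eta>) \<delta> a b
            \<and> (\<forall>a' b'. shortest n (hard_threshold n \<eta>) \<delta> a' b' \<longrightarrow> a' = a \<and> b' = b)
            \<and> a = b
            \<and> Phi (sqrt (real n) * (a - \<eta>)) - Phi (- sqrt (real n) * a) = \<delta>
            \<and> (\<forall>x. Phi (sqrt (real n) * (x - \<eta>)) - Phi (- sqrt (real n) * x) = \<delta> \<longrightarrow> x = a)
            \<and> inf_coverage n (hard_threshold n \<eta>) a b = \<delta>
            \<and> a > \<eta> / 2"
proof -
  interpret thresholding "\<lambda>y. if \<eta> < \<bar>y\<bar> then y else 0" "\<lambda>u. max 0 (\<eta> - u)"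
    by (rule thresholding_hard[OF \<eta>])
  have est: "hard_threshold n \<eta> = estimator n"
    by (simp add: hard_threshold_def fun_eq_iff)
  define E where "E x = mean_cdf n (x - \<eta>) - mean_cdf n (- x)" for x
  have E: "Phi (sqrt (real n) * (x - \<eta>)) - Phi (- sqrt (real n) * x) = E x" for x
    by (simp add: E_def mean_cdf_def)
  \<comment> \<open>Otherwise \<open>x - \<eta> \<le> - x\<close> and \<open>E x\<close> is not positive.\<close>
  have large: "\<eta> / 2 < x" if "E x = \<delta>" for x
    using that \<delta>(1) n unfolding E_def by (smt (verit) mean_cdf_le_iff field_sum_of_halves)
  have eq: "E x = symmetric_coverage n x" if "\<eta> / 2 < x" for x
    using that \<eta> by (simp add: E_def symmetric_coverage_def mean_cdf_uminus max_absorb1 max_absorb2)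
  have small: "symmetric_coverage n x = 0" if "0 \<le> x" "x \<le> \<eta> / 2" for x
    using that mean_cdf_uminus[of n "x - \<eta>"] \<eta> by (simp add: symmetric_coverage_def max_absorb2)
  have "E x = \<delta> \<longleftrightarrow> 0 \<le> x \<and> symmetric_coverage n x = \<delta>" for x
    using large[of x] eq[of x] small[of x] \<eta> \<delta>(1) by (cases "\<eta> / 2 < x") auto
  from unique_shortest_interval[OF n \<delta> this] show ?thesis
    unfolding est E using large by blast
qed

lemma unique_shortest_interval_adaptive:
  fixes n :: nat and \<eta> \<delta> :: real
  assumes \<eta>: "\<eta> > 0" and n: "n \<ge> 1" and \<delta>: "0 < \<delta>" "\<delta> < 1"
  shows "\<exists>a b. shortest n (adaptive_lasso n \<eta>) \<delta> a b
            \<and> (\<forall>a' b'. shortest n (adaptive_lasso n \<eta>) \<delta> a' b' \<longrightarrow> a' = a \<and> b' = b)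
            \<and> a = b
            \<and> Phi (sqrt (real n) * (a - \<eta>)) - Phi (- sqrt (real n) * sqrt (a\<^sup>2 + \<eta>\<^sup>2)) = \<delta>
            \<and> (\<forall>x. Phi (sqrt (real n) * (x - \<eta>)) - Phi (- sqrt (real n) * sqrt (x\<^sup>2 + \<eta>\<^sup>2)) = \<delta> \<longrightarrow> x = a)
            \<and> inf_coverage n (adaptive_lasso n \<eta>) a b = \<delta>
            \<and> a > 0"
proof -
  interpret thresholding "\<lambda>y. if \<bar>y\<bar> \<le> \<eta> then 0 else y - \<eta>\<^sup>2 / y"
      "\<lambda>u. (sqrt (u\<^sup>2 + 4 * \<eta>\<^sup>2) - u) / 2"
    by (rule thresholding_adaptive[OF \<eta>])
  have est: "adaptive_lasso n \<eta> = estimator n"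
    by (simp add: adaptive_lasso_def fun_eq_iff)
  have E: "Phi (- sqrt (real n) * y) = mean_cdf n (- y)" for y
    by (simp add: mean_cdf_def)
  have eq: "mean_cdf n (x - \<eta>) - mean_cdf n (- sqrt (x\<^sup>2 + \<eta>\<^sup>2)) = symmetric_coverage n x" for x
  proof -
    have "sqrt ((2 * x)\<^sup>2 + 4 * \<eta>\<^sup>2) = sqrt (2\<^sup>2 * (x\<^sup>2 + \<eta>\<^sup>2))"
      by (simp add: power_mult_distrib)
    also have "\<dots> = 2 * sqrt (x\<^sup>2 + \<eta>\<^sup>2)"
      by (simp only: real_sqrt_mult) simp
    finally have "(sqrt ((2 * x)\<^sup>2 + 4 * \<eta>\<^sup>2) - 2 * x) / 2 = sqrt (x\<^sup>2 + \<eta>\<^sup>2) - x"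
      by simp
    moreover have "(sqrt (0\<^sup>2 + 4 * \<eta>\<^sup>2) - 0) / 2 = \<eta>"
      using real_sqrt_unique[of "2 * \<eta>" "4 * \<eta>\<^sup>2"] \<eta> by (simp add: power_mult_distrib)
    ultimately show ?thesis
      unfolding symmetric_coverage_def by (simp only: mean_cdf_uminus) simp
  qed
  have nonneg: "0 \<le> x" if "symmetric_coverage n x = \<delta>" for x
  proof (rule ccontr)
    assume "\<not> 0 \<le> x"
    then have "sqrt (x\<^sup>2 + \<eta>\<^sup>2) \<le> \<eta> - x"
      using \<eta> by (intro real_le_lsqrt) (auto simp: power2_diff mult_le_0_iff)
    then have "mean_cdf n (x - \<eta>) \<le> mean_cdf n (- sqrt (x\<^sup>2 + \<eta>\<^sup>2))"
      using n by simp
    then show False using that \<delta>(1) unfolding eq[symmetric] by simp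
  qed
  show ?thesis
    unfolding est E mean_cdf_def[symmetric] eq
    by (rule unique_shortest_interval[OF n \<delta>]) (use nonneg in blast)
qed

theorem theorem5:
  fixes n :: nat and \<eta> \<delta> :: real
  assumes "\<eta> > 0" and "n \<ge> 1" and "0 < \<delta>" and "\<delta> < 1"
  shows "(\<exists>a b. shortest n (soft_threshold n \<eta>) \<delta> a b
            \<and> (\<forall>a' b'. shortest n (soft_threshold n \<eta>) \<delta> a' b' \<longrightarrow> a' = a \<and> b' = b)
            \<and> a = b
            \<and> Phi (sqrt (real n) * (a - \<eta>)) - Phi (sqrt (real n) * (- a - \<eta>)) = \<delta>
            \<and> (\<forall>x. Phi (sqrt (real n) * (x - \<eta>)) - Phi (sqrt (real n) * (- x - \<eta>)) = \<delta> \<longrightarrow> x = a)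
            \<and> inf_coverage n (soft_threshold n \<eta>) a b = \<delta>
            \<and> a > 0)
    \<and> (\<exists>a b. shortest n (hard_threshold n \<eta>) \<delta> a b
            \<and> (\<forall>a' b'. shortest n (hard_threshold n \<eta>) \<delta> a' b' \<longrightarrow> a' = a \<and> b' = b)
            \<and> a = b
            \<and> Phi (sqrt (real n) * (a - \<eta>)) - Phi (- sqrt (real n) * a) = \<delta>
            \<and> (\<forall>x. Phi (sqrt (real n) * (x - \<eta>)) - Phi (- sqrt (real n) * x) = \<delta> \<longrightarrow> x = a)
            \<and> inf_coverage n (hard_threshold n \<eta>) a b = \<delta>
            \<and> a > \<eta> / 2)
    \<and> (\<exists>a b. shortest n (adaptive_lasso n \<eta>) \<delta> a b
            \<and> (\<forall>a' b'. shortest n (adaptive_lasso n \<eta>) \<delta> a' b' \<longrightarrow> a' = a \<and> b' = b)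
            \<and> a = b
            \<and> Phi (sqrt (real n) * (a - \<eta>)) - Phi (- sqrt (real n) * sqrt (a\<^sup>2 + \<eta>\<^sup>2)) = \<delta>
            \<and> (\<forall>x. Phi (sqrt (real n) * (x - \<eta>)) - Phi (- sqrt (real n) * sqrt (x\<^sup>2 + \<eta>\<^sup>2)) = \<delta> \<longrightarrow> x = a)
            \<and> inf_coverage n (adaptive_lasso n \<eta>) a b = \<delta>
            \<and> a > 0)"
  using unique_shortest_interval_soft[OF assms] unique_shortest_interval_hard[OF assms]
    unique_shortest_interval_adaptive[OF assms]
  by blast

end
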